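(* Consider the sequence of nested models $M_{\mathbf l(j)}$, $j=0,\dots,k$, where $\mathbf l(j)=(1,\dots,1,0,\dots,0)$ has $j$ ones followed by $k-j$ zeroes. Suppose that (1) $\mathbf Q=\gamma\mathbf X'\mathbf X$ for some $\gamma>0$; and (2) there is $b>0$, the same for all models, such that $\widetilde{\boldsymbol\beta}_{\mathbf l}=b\widehat{\boldsymbol\beta}_{\mathbf l}$ for every model $M_{\mathbf l}$ in the sequence, where $\widehat{\boldsymbol\beta}_{\mathbf l}=(\mathbf X_{\mathbf l}'\mathbf X_{\mathbf l})^{-1}\mathbf X_{\mathbf l}'\mathbf y$ is the least squares estimate. Then the best predictive model is the median probability model, given either by $M_{\mathbf l^*}$ with $l_i^*=1$ if $p_i\ge\frac12$ and $l_i^*=0$ otherwise, or by $M_{\mathbf l(j^* )}$ with $j^*$ such that $$\sum_{i=0}^{j^*-1}P(M_{\mathbf l(i)}|\mathbf y)<\tfrac12\quad\text{and}\quad\sum_{i=0}^{j^*}P(M_{\mathbf l(i)}|\mathbf y)\ge\tfrac12 .$$ (That is, the model given by either description minimizes $R$ over the sequence.)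
   Context: Full model: $\mathbf y=\mathbf X\boldsymbol\beta+\boldsymbol\varepsilon$, with $\mathbf y\in\mathbb R^n$ observed, $\mathbf X$ an $n\times k$ ($k<n$) design matrix of full rank (not necessarily with orthogonal columns), $\boldsymbol\beta\in\mathbb R^k$ unknown, and $\boldsymbol\varepsilon$ having independent $N(0,\sigma^2)$ coordinates ($\sigma^2$ known or unknown). For an index $\mathbf l=(l_1,\dots,l_k)\in\{0,1\}^k$, the submodel is $M_{\mathbf l}:\ \mathbf y=\mathbf X_{\mathbf l}\boldsymbol\beta_{\mathbf l}+\boldsymbol\varepsilon$, where $\mathbf X_{\mathbf l}$ consists of the columns $i$ of $\mathbf X$ with $l_i=1$; $k_{\mathbf l}=\sum_i l_i$. All sums over $\mathbf l$ are over the models under consideration. Posterior inputs: for each model under consideration a posterior probability $p_{\mathbf l}=P(M_{\mathbf l}|\mathbf y)\ge 0$, with $\sum_{\mathbf l}p_{\mathbf l}=1$, and a posterior distribution $\pi_{\mathbf l}(\boldsymbol\beta_{\mathbf l},\sigma|\mathbf y)$, with posterior mean $\widetilde{\boldsymbol\beta}_{\mathbf l}\in\mathbb R^{k_{\mathbf l}}$ of $\boldsymbol\beta_{\mathbf l}$. (These inputs need not arise from a single coherent prior.) $\mathbf H_{\mathbf l}$ is the $k\times k_{\mathbf l}$ matrix whose $(i,j)$ entry is $1$ if $l_i=1$ and $j=\sum_{r=1}^i l_r$, and $0$ otherwise; for $\mathbf l=\mathbf 0$, $\mathbf H_{\mathbf l}\widetilde{\boldsymbol\beta}_{\mathbf l}$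 is the zero vector. Set $\bar{\boldsymbol\beta}=\sum_{\mathbf l}p_{\mathbf l}\mathbf H_{\mathbf l}\widetilde{\boldsymbol\beta}_{\mathbf l}$. Prediction: a future $y^*=\mathbf x^*\boldsymbol\beta+\varepsilon$ is predicted under squared error loss, by $\widehat y^*_{\mathbf l}=\mathbf x^*\mathbf H_{\mathbf l}\widetilde{\boldsymbol\beta}_{\mathbf l}$ if $M_{\mathbf l}$ is used; the random row vector $\mathbf x^*$ of future covariates has $\mathbf Q=\mathbf E[(\mathbf x^* )'(\mathbf x^* )]$ existing and positive definite. Define $$R(M_{\mathbf l})=(\mathbf H_{\mathbf l}\widetilde{\boldsymbol\beta}_{\mathbf l}-\bar{\boldsymbol\beta})'\mathbf Q(\mathbf H_{\mathbf l}\widetilde{\boldsymbol\beta}_{\mathbf l}-\bar{\boldsymbol\beta}).$$ The best predictive model is the model under consideration minimizing $R(M_{\mathbf l})$ (equivalently, minimizing the posterior expected predictive squared error loss, which differs from $R(M_{\mathbf l})$ by a constant not depending on $\mathbf l$). The posterior inclusion probability of variable $i$ is $p_i=\sum_{\mathbf l:\,l_i=1}p_{\mathbf l}$. The two descriptions of the median probability model can differ only when some partial sum of the posterior model probabilities equals exactly $\frac12$. *)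

theory Defs
  imports
    "HOL-Probability.Probability"
    "Jordan_Normal_Form.Gauss_Jordan_Elimination"
    "Jordan_Normal_Form.DL_Rank"
    "Jordan_Normal_Form.DL_Submatrix"
begin

unbundle no vec_syntax
unbundle no inner_syntax
hide_const (open) Finite_Cartesian_Product.vec Finite_Cartesian_Product.row
  Finite_Cartesian_Product.mat Determinants.det

text \<open>
  Vectors and matrices are those of Jordan_Normal_Form, because the dimension of a submodel
  depends on its index. Indices start at 0: variable \<open>i\<close> of \<open>{1..k}\<close> is coordinate \<open>i - 1\<close>.
  A model index is a \<^typ>\<open>nat vec\<close> of dimension \<open>k\<close> with entries in \<open>{0, 1}\<close>.
\<close>

definition model_size :: "nat vec \<Rightarrow> nat" where
  "model_size l = (\<Sum>i<dim_vec l. l $ i)"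

definition submodel_design :: "real mat \<Rightarrow> nat vec \<Rightarrow> real mat" where
  "submodel_design X l = submatrix X UNIV {i. i < dim_vec l \<and> l $ i = 1}"

text \<open>Column \<open>j\<close> (from 0) of the embedding matrix is the unit vector of the \<open>(j + 1)\<close>-st variable
  included in the model.\<close>

definition embed_mat :: "nat vec \<Rightarrow> real mat" where
  "embed_mat l = mat (dim_vec l) (model_size l)
     (\<lambda>(i, j). if l $ i = 1 \<and> j + 1 = (\<Sum>r\<le>i. l $ r) then 1 else 0)"

text \<open>The option is \<^const>\<open>None\<close> only if the Gram matrix is singular, which full column rank
  excludes.\<close>

definition least_squares :: "real mat \<Rightarrow> real vec \<Rightarrow> nat vec \<Rightarrow> real vec" where
  "least_squares X y l =
     the (mat_inverse ((submodel_design X l)\<^sup>T * submodel_design X l))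
       *\<^sub>v ((submodel_design X l)\<^sup>T *\<^sub>v y)"

text \<open>A posterior on \<open>\<real>\<^sup>m \<times> \<real>\<close> for the coefficients and the error standard deviation.
  A known standard deviation corresponds to a point mass in the second component.
  Integrability makes the posterior mean meaningful.\<close>

definition posterior_with_mean :: "nat \<Rightarrow> ((nat \<Rightarrow> real) \<times> real) measure \<Rightarrow> bool" where
  "posterior_with_mean m N \<longleftrightarrow>
     prob_space N \<and>
     sets N = sets ((\<Pi>\<^sub>M i\<in>{..<m}. borel) \<Otimes>\<^sub>M borel) \<and>
     (\<forall>i<m. integrable N (\<lambda>(\<beta>, \<sigma>). \<beta> i))"

definition posterior_mean :: "nat \<Rightarrow> ((nat \<Rightarrow> real) \<times> real) measure \<Rightarrow> real vec" where
  "posterior_mean m N = vec m (\<lambda>i. LINT (\<beta>, \<sigma>)|N. \<beta> i)"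

definition embedded_mean ::
  "(nat vec \<Rightarrow> ((nat \<Rightarrow> real) \<times> real) measure) \<Rightarrow> nat vec \<Rightarrow> real vec" where
  "embedded_mean post l = embed_mat l *\<^sub>v posterior_mean (model_size l) (post l)"

definition model_average ::
  "nat \<Rightarrow> nat vec set \<Rightarrow> (nat vec \<Rightarrow> real) \<Rightarrow>
     (nat vec \<Rightarrow> ((nat \<Rightarrow> real) \<times> real) measure) \<Rightarrow> real vec" where
  "model_average k L p post =
     finsum_vec TYPE(real) k (\<lambda>l. p l \<cdot>\<^sub>v embedded_mean post l) L"

text \<open>The future covariates form a random row vector, that is, a random \<open>1 \<times> k\<close> matrix.\<close>

definition random_row :: "nat \<Rightarrow> 'w measure \<Rightarrow> ('w \<Rightarrow> real mat) \<Rightarrow> bool" where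
  "random_row k M x \<longleftrightarrow>
     (\<forall>\<omega>\<in>space M. x \<omega> \<in> carrier_mat 1 k) \<and>
     (\<forall>i<k. (\<lambda>\<omega>. x \<omega> $$ (0, i)) \<in> borel_measurable M)"

definition second_moment_exists :: "nat \<Rightarrow> 'w measure \<Rightarrow> ('w \<Rightarrow> real mat) \<Rightarrow> bool" where
  "second_moment_exists k M x \<longleftrightarrow>
     (\<forall>i<k. \<forall>j<k. integrable M (\<lambda>\<omega>. ((x \<omega>)\<^sup>T * x \<omega>) $$ (i, j)))"

definition second_moment :: "nat \<Rightarrow> 'w measure \<Rightarrow> ('w \<Rightarrow> real mat) \<Rightarrow> real mat" where
  "second_moment k M x = mat k k (\<lambda>(i, j). LINT \<omega>|M. ((x \<omega>)\<^sup>T * x \<omega>) $$ (i, j))"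

definition positive_definite :: "nat \<Rightarrow> real mat \<Rightarrow> bool" where
  "positive_definite k A \<longleftrightarrow> A \<in> carrier_mat k k \<and> A\<^sup>T = A \<and>
     (\<forall>v\<in>carrier_vec k. v \<noteq> 0\<^sub>v k \<longrightarrow> v \<bullet> (A *\<^sub>v v) > 0)"

text \<open>The posterior expected predictive squared error loss of a model, up to an additive constant
  that does not depend on the model.\<close>

definition predictive_risk ::
  "real mat \<Rightarrow> nat vec set \<Rightarrow> (nat vec \<Rightarrow> real) \<Rightarrow>
     (nat vec \<Rightarrow> ((nat \<Rightarrow> real) \<times> real) measure) \<Rightarrow> nat vec \<Rightarrow> real" where
  "predictive_risk Q L p post l =
     (let d = embedded_mean post l - model_average (dim_row Q) L p post
      in d \<bullet> (Q *\<^sub>v d))"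

text \<open>Ties are possible, so being best is a predicate on models.\<close>

definition best_predictive_model ::
  "real mat \<Rightarrow> nat vec set \<Rightarrow> (nat vec \<Rightarrow> real) \<Rightarrow>
     (nat vec \<Rightarrow> ((nat \<Rightarrow> real) \<times> real) measure) \<Rightarrow> nat vec \<Rightarrow> bool" where
  "best_predictive_model Q L p post = is_arg_min (predictive_risk Q L p post) (\<lambda>l. l \<in> L)"

definition inclusion_prob :: "nat vec set \<Rightarrow> (nat vec \<Rightarrow> real) \<Rightarrow> nat \<Rightarrow> real" where
  "inclusion_prob L p i = (\<Sum>l\<in>{l\<in>L. l $ i = 1}. p l)"

definition median_model :: "nat \<Rightarrow> nat vec set \<Rightarrow> (nat vec \<Rightarrow> real) \<Rightarrow> nat vec" where
  "median_model k L p = vec k (\<lambda>i. if inclusion_prob L p i \<ge> 1 / 2 then 1 else 0)"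

definition nested_index :: "nat \<Rightarrow> nat \<Rightarrow> nat vec" where
  "nested_index k j = vec k (\<lambda>i. if i < j then 1 else 0)"

definition nested_models :: "nat \<Rightarrow> nat vec set" where
  "nested_models k = nested_index k ` {0..k}"

definition is_median_position :: "nat \<Rightarrow> (nat vec \<Rightarrow> real) \<Rightarrow> nat \<Rightarrow> bool" where
  "is_median_position k p j \<longleftrightarrow> j \<le> k \<and>
     (\<Sum>i<j. p (nested_index k i)) < 1 / 2 \<and>
     (\<Sum>i\<le>j. p (nested_index k i)) \<ge> 1 / 2"

end

theory Submission
  imports Defs
begin

text \<open>
  Write \<open>V\<^sub>j\<close> for the embedded posterior mean of the nested model with \<open>j\<close> variables and
  \<open>\<langle>u, w\<rangle>\<close> for \<open>u \<bullet> (Q *\<^sub>v w)\<close>. Since \<open>Q\<close> is a multiple of the full Gram matrix, the fitted values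
  \<open>X *\<^sub>v V\<^sub>j\<close> are \<open>b\<close> times the orthogonal projections of \<open>y\<close> onto an increasing chain of column
  spaces, and \<open>\<langle>_, _\<rangle>\<close> is \<open>\<gamma>\<close> times the inner product of the fitted values. For \<open>i \<le> j\<close> the
  projection onto the larger space does not affect the pairing with a vector of the smaller one,
  so \<open>\<langle>V\<^sub>i, V\<^sub>j\<rangle>\<close> depends only on \<open>i\<close> (\<open>nested_embedded_means\<close>). Call it \<open>c\<^sub>i\<close>. Then
  \<open>0 \<le> \<langle>V\<^sub>j - V\<^sub>i, V\<^sub>j - V\<^sub>i\<rangle> = c\<^sub>j - c\<^sub>i\<close>, so \<open>c\<close> is nondecreasing and
  \<open>\<langle>V\<^sub>i, V\<^sub>j\<rangle> = min c\<^sub>i c\<^sub>j\<close> for all \<open>i\<close> and \<open>j\<close>.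

  Expanding the risk of model \<open>j\<close> around the model average gives, up to a constant,
  \<open>c\<^sub>j - 2 (\<Sum>i. p\<^sub>i min c\<^sub>i c\<^sub>j)\<close>. The weights sum to 1 and
  \<open>c\<^sub>i + c\<^sub>j - 2 min c\<^sub>i c\<^sub>j = \<bar>c\<^sub>i - c\<^sub>j\<bar>\<close>, so up to another constant the risk is the expected absolute
  deviation \<open>\<Sum>i. p\<^sub>i \<bar>c\<^sub>i - c\<^sub>j\<bar>\<close> (\<open>nested_risk_eq_abs_deviation\<close>). A weighted median minimizes
  this (\<open>weighted_median_minimizes_abs_deviation\<close>). Both descriptions of the median probability
  model are weighted medians: the one by partial sums by definition, and the one by inclusion
  probabilities because, in a nested sequence, the inclusion probability of a variable is 1 minus
  the partial sum up to the last model without it (\<open>median_model_nested\<close>). When a partial sum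
  equals 1/2 the two may pick different weighted medians.
\<close>

section \<open>Weighted medians\<close>

text \<open>Moving away from \<open>c m\<close> by a distance \<open>d\<close> adds \<open>d\<close> to the deviation from all points left
  behind, and these, the median included, carry at least half of the weight; it removes at most \<open>d\<close>
  from the others. Both bounds on the partial sums are weak, so that every weighted median is
  covered when ties occur.\<close>

lemma weighted_median_minimizes_abs_deviation:
  fixes p c :: "nat \<Rightarrow> real"
  assumes p_nonneg: "\<And>i. i \<le> k \<Longrightarrow> p i \<ge> 0" and p_sum: "(\<Sum>i\<le>k. p i) = 1"
    and c_mono: "\<And>i j. i \<le> j \<Longrightarrow> j \<le> k \<Longrightarrow> c i \<le> c j"
    and m: "m \<le> k" and before: "(\<Sum>i<m. p i) \<le> 1 / 2" and upto: "(\<Sum>i\<le>m. p i) \<ge> 1 / 2"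
    and j: "j \<le> k"
  shows "(\<Sum>i\<le>k. p i * \<bar>c i - c m\<bar>) \<le> (\<Sum>i\<le>k. p i * \<bar>c i - c j\<bar>)"
proof (cases "m \<le> j")
  case True
  \<comment> \<open>In units of \<open>c j - c m\<close>, a lower bound for the change of the deviation from the \<open>i\<close>-th point.\<close>
  define s :: "nat \<Rightarrow> real" where "s i = (if i \<le> m then 1 else -1)" for i
  have "(\<Sum>i\<le>k. p i * s i) = (\<Sum>i\<le>k. 2 * (if i \<le> m then p i else 0) - p i)"
    by (intro sum.cong) (auto simp: s_def)
  also have "\<dots> = 2 * (\<Sum>i\<le>k. if i \<le> m then p i else 0) - 1"
    by (simp add: sum_subtractf p_sum flip: sum_distrib_left)
  also have "(\<Sum>i\<le>k. if i \<le> m then p i else 0) = (\<Sum>i\<le>m. p i)"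
    using m by (intro sum.mono_neutral_cong_right) auto
  finally have "0 \<le> (\<Sum>i\<le>k. p i * s i)"
    using upto by simp
  then have "0 \<le> (c j - c m) * (\<Sum>i\<le>k. p i * s i)"
    using c_mono[OF True j] by simp
  also have "\<dots> = (\<Sum>i\<le>k. p i * ((c j - c m) * s i))"
    by (simp add: sum_distrib_left algebra_simps)
  also have "\<dots> \<le> (\<Sum>i\<le>k. p i * (\<bar>c i - c j\<bar> - \<bar>c i - c m\<bar>))"
  proof (intro sum_mono mult_left_mono)
    fix i assume i: "i \<in> {..k}"
    show "(c j - c m) * s i \<le> \<bar>c i - c j\<bar> - \<bar>c i - c m\<bar>"
      using c_mono[of i m] c_mono[OF True j] m by (auto simp: s_def)
  qed (simp add: p_nonneg)
  finally show ?thesis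
    by (simp add: right_diff_distrib sum_subtractf)
next
  case False
  then have jm: "j \<le> m" by simp
  define s :: "nat \<Rightarrow> real" where "s i = (if i < m then -1 else 1)" for i
  have "(\<Sum>i\<le>k. p i * s i) = (\<Sum>i\<le>k. p i - 2 * (if i < m then p i else 0))"
    by (intro sum.cong) (auto simp: s_def)
  also have "\<dots> = 1 - 2 * (\<Sum>i\<le>k. if i < m then p i else 0)"
    by (simp add: sum_subtractf p_sum flip: sum_distrib_left)
  also have "(\<Sum>i\<le>k. if i < m then p i else 0) = (\<Sum>i<m. p i)"
    using m by (intro sum.mono_neutral_cong_right) auto
  finally have "0 \<le> (\<Sum>i\<le>k. p i * s i)"
    using before by simp
  then have "0 \<le> (c m - c j) * (\<Sum>i\<le>k. p i * s i)"
    using c_mono[OF jm m] by simp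
  also have "\<dots> = (\<Sum>i\<le>k. p i * ((c m - c j) * s i))"
    by (simp add: sum_distrib_left algebra_simps)
  also have "\<dots> \<le> (\<Sum>i\<le>k. p i * (\<bar>c i - c j\<bar> - \<bar>c i - c m\<bar>))"
  proof (intro sum_mono mult_left_mono)
    fix i assume i: "i \<in> {..k}"
    show "(c m - c j) * s i \<le> \<bar>c i - c j\<bar> - \<bar>c i - c m\<bar>"
      using c_mono[of m i] c_mono[OF jm m] i by (auto simp: s_def)
  qed (simp add: p_nonneg)
  finally show ?thesis
    by (simp add: right_diff_distrib sum_subtractf)
qed

lemma exists_weighted_median:
  fixes p :: "nat \<Rightarrow> real"
  assumes "(\<Sum>i\<le>k. p i) \<ge> 1 / 2"
  shows "\<exists>j\<le>k. (\<Sum>i<j. p i) < 1 / 2 \<and> (\<Sum>i\<le>j. p i) \<ge> 1 / 2"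
proof -
  define j where "j = (LEAST j. (\<Sum>i\<le>j. p i) \<ge> 1 / 2)"
  have "(\<Sum>i\<le>j. p i) \<ge> 1 / 2" "j \<le> k"
    unfolding j_def by (rule LeastI, fact) (rule Least_le, fact)
  moreover have "(\<Sum>i<j. p i) < 1 / 2"
  proof (cases j)
    case (Suc j')
    then have "\<not> (\<Sum>i\<le>j'. p i) \<ge> 1 / 2"
      unfolding j_def by (intro not_less_Least) simp
    then show ?thesis using Suc by (simp add: lessThan_Suc_atMost)
  qed simp
  ultimately show ?thesis by blast
qed

section \<open>Least squares\<close>

lemma scalar_prod_finsum_vec:
  fixes u :: "real vec"
  assumes "finite L" and u: "u \<in> carrier_vec k" and f: "f \<in> L \<rightarrow> carrier_vec k"
  shows "u \<bullet> finsum_vec TYPE(real) k f L = (\<Sum>l\<in>L. u \<bullet> f l)"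
proof -
  have dim: "dim_vec (finsum_vec TYPE(real) k f L) = k"
    using finsum_vec_closed[OF f] by simp
  have "u \<bullet> finsum_vec TYPE(real) k f L = (\<Sum>i<k. u $ i * (\<Sum>l\<in>L. f l $ i))"
    unfolding scalar_prod_def dim atLeast0LessThan
    by (intro sum.cong refl) (simp add: index_finsum_vec[OF \<open>finite L\<close> _ f])
  also have "\<dots> = (\<Sum>l\<in>L. \<Sum>i<k. u $ i * f l $ i)"
    unfolding sum_distrib_left by (rule sum.swap)
  also have "\<dots> = (\<Sum>l\<in>L. u \<bullet> f l)"
  proof (intro sum.cong refl)
    fix l assume "l \<in> L"
    then have "dim_vec (f l) = k" using Pi_mem[OF f] carrier_vecD by blast
    then show "(\<Sum>i<k. u $ i * f l $ i) = u \<bullet> f l"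
      by (simp add: scalar_prod_def atLeast0LessThan)
  qed
  finally show ?thesis .
qed

lemma gram_scalar_prod:
  fixes A :: "real mat"
  assumes A: "A \<in> carrier_mat n m" and u: "u \<in> carrier_vec m" and v: "v \<in> carrier_vec m"
  shows "u \<bullet> ((A\<^sup>T * A) *\<^sub>v v) = (A *\<^sub>v u) \<bullet> (A *\<^sub>v v)"
proof -
  have "(A *\<^sub>v u) \<bullet> (A *\<^sub>v v) = (A\<^sup>T *\<^sub>v (A *\<^sub>v v)) \<bullet> u"
    using transpose_vec_mult_scalar[OF A u, of "A *\<^sub>v v"] A u v
      comm_scalar_prod[of "A *\<^sub>v u" n "A *\<^sub>v v"] by auto
  also have "\<dots> = u \<bullet> ((A\<^sup>T * A) *\<^sub>v v)"
    using A u v by (subst comm_scalar_prod[of _ m]) (auto simp: assoc_mult_mat_vec[of _ m n _ m])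
  finally show ?thesis by simp
qed

lemma scalar_prod_self_eq_0:
  fixes v :: "real vec"
  assumes "v \<in> carrier_vec n" and "v \<bullet> v = 0"
  shows "v = 0\<^sub>v n"
  using conjugate_square_eq_0_vec[of v n] assms by simp

text \<open>The projection property of least squares: the fitted values \<open>A *\<^sub>v B\<close> and the data \<open>y\<close> have the
  same inner product with every vector in the column space of \<open>A\<close>. Full column rank, stated as
  injectivity, makes the Gram matrix invertible because its kernel is that of \<open>A\<close>.\<close>

lemma normal_equations:
  fixes A :: "real mat"
  assumes A: "A \<in> carrier_mat n m" and y: "y \<in> carrier_vec n"
    and inj: "\<And>v. v \<in> carrier_vec m \<Longrightarrow> A *\<^sub>v v = 0\<^sub>v n \<Longrightarrow> v = 0\<^sub>v m"
    and w: "w \<in> carrier_vec m"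
    and B_def: "B = the (mat_inverse (A\<^sup>T * A)) *\<^sub>v (A\<^sup>T *\<^sub>v y)"
  shows "B \<in> carrier_vec m" and "(A *\<^sub>v w) \<bullet> (A *\<^sub>v B) = (A *\<^sub>v w) \<bullet> y"
proof -
  let ?G = "A\<^sup>T * A"
  have G: "?G \<in> carrier_mat m m" using A by simp
  have "det ?G \<noteq> 0"
  proof
    assume "det ?G = 0"
    then obtain v where v: "v \<in> carrier_vec m" "v \<noteq> 0\<^sub>v m" "?G *\<^sub>v v = 0\<^sub>v m"
      unfolding det_0_iff_vec_prod_zero[OF G] by blast
    have "(A *\<^sub>v v) \<bullet> (A *\<^sub>v v) = 0"
      using gram_scalar_prod[OF A v(1) v(1)] v by simp
    then have "A *\<^sub>v v = 0\<^sub>v n"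
      using A v(1) by (intro scalar_prod_self_eq_0) auto
    with inj v show False by blast
  qed
  then have "mat_inverse ?G \<noteq> None"
    using mat_inverse(1)[OF G, where b = "()"] det_non_zero_imp_unit[OF G, where b = "()"] by blast
  then obtain C where C: "mat_inverse ?G = Some C" by blast
  then have inv: "?G * C = 1\<^sub>m m" and C_carrier: "C \<in> carrier_mat m m"
    using mat_inverse(2)[OF G] by blast+
  have z: "A\<^sup>T *\<^sub>v y \<in> carrier_vec m" using A y by simp
  have B: "B = C *\<^sub>v (A\<^sup>T *\<^sub>v y)" by (simp add: B_def C)
  show B_carrier: "B \<in> carrier_vec m" using B C_carrier z by simp
  have "?G *\<^sub>v B = A\<^sup>T *\<^sub>v y"
    unfolding B using assoc_mult_mat_vec[OF G C_carrier z] inv z by simp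
  then have "(A *\<^sub>v w) \<bullet> (A *\<^sub>v B) = w \<bullet> (A\<^sup>T *\<^sub>v y)"
    using gram_scalar_prod[OF A w B_carrier] by simp
  also have "\<dots> = (A *\<^sub>v w) \<bullet> y"
    using transpose_vec_mult_scalar[OF A w y] A w y z
      comm_scalar_prod[OF w z] comm_scalar_prod[of "A *\<^sub>v w" n y] by simp
  finally show "(A *\<^sub>v w) \<bullet> (A *\<^sub>v B) = (A *\<^sub>v w) \<bullet> y" .
qed

section \<open>Nested models\<close>

lemma sum_nested_index:
  assumes "j \<le> k" "i < k"
  shows "(\<Sum>r\<le>i. nested_index k j $ r) = min (Suc i) j"
proof -
  have "(\<Sum>r\<le>i. nested_index k j $ r) = (\<Sum>r\<le>i. if r < j then 1 else 0)"
    using assms by (intro sum.cong) (auto simp: nested_index_def)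
  also have "\<dots> = card {r. r \<le> i \<and> r < j}"
    by (simp add: sum.If_cases Int_def)
  also have "{r. r \<le> i \<and> r < j} = {..<min (Suc i) j}" by auto
  finally show ?thesis by simp
qed

lemma model_size_nested: "j \<le> k \<Longrightarrow> model_size (nested_index k j) = j"
  using sum_nested_index[of j k "k - 1"]
  by (cases k) (auto simp: model_size_def nested_index_def lessThan_Suc_atMost)

lemma embed_mat_nested:
  assumes "j \<le> k"
  shows "embed_mat (nested_index k j) = mat k j (\<lambda>(r, c). if r = c then 1 else 0)"
proof -
  have "dim_vec (nested_index k j) = k" by (simp add: nested_index_def)
  moreover have "nested_index k j $ r = 1 \<longleftrightarrow> r < j" if "r < k" for r
    using that by (simp add: nested_index_def)
  ultimately show ?thesis
    using assms
    by (intro eq_matI) (auto simp: embed_mat_def model_size_nested sum_nested_index simp del: One_nat_def)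
qed

lemma embed_mat_nested_carrier:
  "j \<le> k \<Longrightarrow> embed_mat (nested_index k j) \<in> carrier_mat k j"
  by (simp add: embed_mat_nested)

lemma mult_embed_mat_nested:
  assumes "A \<in> carrier_mat n k" "j \<le> k"
  shows "A * embed_mat (nested_index k j) = mat n j (\<lambda>(r, c). A $$ (r, c))"
proof (rule eq_matI)
  fix r c assume "r < dim_row (mat n j (\<lambda>(r, c). A $$ (r, c)))"
    and "c < dim_col (mat n j (\<lambda>(r, c). A $$ (r, c)))"
  then have rc: "r < n" "c < j" by auto
  have "(A * embed_mat (nested_index k j)) $$ (r, c)
      = (\<Sum>i<k. A $$ (r, i) * (if i = c then 1 else 0))"
    using assms rc
    by (auto simp: embed_mat_nested scalar_prod_def atLeast0LessThan intro!: sum.cong)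
  also have "\<dots> = A $$ (r, c)"
    using assms rc by (simp add: if_distrib[of "\<lambda>x. _ * x"] cong: if_cong)
  finally show "(A * embed_mat (nested_index k j)) $$ (r, c)
      = mat n j (\<lambda>(r, c). A $$ (r, c)) $$ (r, c)"
    using rc by simp
qed (use assms in \<open>auto simp: embed_mat_nested\<close>)

text \<open>Embedding into the full coefficient space factors through every larger nested model. So an
  embedded vector of a smaller model is also one of each larger model.\<close>

lemma embed_mat_nested_trans:
  assumes "i \<le> j" "j \<le> k"
  shows "embed_mat (nested_index k j) * embed_mat (nested_index j i) = embed_mat (nested_index k i)"
  using assms
  by (subst mult_embed_mat_nested[of _ k])
    (auto simp: embed_mat_nested_carrier embed_mat_nested intro!: eq_matI)

lemma embed_mat_nested_inj:
  assumes j: "j \<le> k" and v: "v \<in> carrier_vec j"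
    and zero: "embed_mat (nested_index k j) *\<^sub>v v = 0\<^sub>v k"
  shows "v = 0\<^sub>v j"
proof (rule eq_vecI)
  fix c assume "c < dim_vec (0\<^sub>v j :: real vec)"
  then have c: "c < j" by simp
  have "(embed_mat (nested_index k j) *\<^sub>v v) $ c = (\<Sum>i<j. (if c = i then 1 else 0) * v $ i)"
    using j v c by (auto simp: embed_mat_nested scalar_prod_def atLeast0LessThan intro!: sum.cong)
  also have "\<dots> = v $ c"
    using c by (simp add: if_distrib[of "\<lambda>x. x * _"] cong: if_cong)
  finally show "v $ c = (0\<^sub>v j :: real vec) $ c"
    using zero j c by simp
qed (use v in simp)

lemma submodel_design_nested:
  assumes X: "X \<in> carrier_mat n k" and j: "j \<le> k"
  shows "submodel_design X (nested_index k j) = X * embed_mat (nested_index k j)"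
proof -
  let ?J = "{i. i < dim_vec (nested_index k j) \<and> nested_index k j $ i = 1}"
  have J: "?J = {..<j}"
    using j by (auto simp: nested_index_def split: if_splits)
  have cols: "{c. c < k \<and> c < j} = {..<j}"
    using j by auto
  show ?thesis
    unfolding mult_embed_mat_nested[OF X j] submodel_design_def J
  proof (rule eq_matI)
    fix r c assume "r < dim_row (mat n j (\<lambda>(r, c). X $$ (r, c)))"
      and "c < dim_col (mat n j (\<lambda>(r, c). X $$ (r, c)))"
    then have rc: "r < n" "c < j" by auto
    have "{a \<in> {..<j}. a < c} = {..<c}" using rc by auto
    then show "submatrix X UNIV {..<j} $$ (r, c) = mat n j (\<lambda>(r, c). X $$ (r, c)) $$ (r, c)"
      using submatrix_index_card[of r X c UNIV "{..<j}"] X j rc by (simp flip: lessThan_def)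
  qed (use X in \<open>auto simp: dim_submatrix cols\<close>)
qed

lemma inj_on_nested_index: "inj_on (nested_index k) {..k}"
  by (rule inj_onI) (metis atMost_iff model_size_nested)

lemma sum_nested_models:
  "(\<Sum>l\<in>nested_models k. f l) = (\<Sum>i\<le>k. f (nested_index k i))"
  unfolding nested_models_def
  by (simp add: atLeast0AtMost sum.reindex[OF inj_on_nested_index])

text \<open>With 0-based indices, variable \<open>i\<close> is missing exactly from the models with at most \<open>i\<close>
  variables.\<close>

lemma inclusion_prob_nested:
  assumes "i < k"
  shows "inclusion_prob (nested_models k) p i
    = (\<Sum>l\<in>nested_models k. p l) - (\<Sum>j\<le>i. p (nested_index k j))"
proof -
  have fin: "finite (nested_models k)" by (simp add: nested_models_def)
  have "inclusion_prob (nested_models k) p i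
      = (\<Sum>l\<in>nested_models k. if l $ i = 1 then p l else 0)"
    unfolding inclusion_prob_def by (rule sum.inter_filter[OF fin])
  also have "\<dots> = (\<Sum>j\<le>k. p (nested_index k j) - (if j \<le> i then p (nested_index k j) else 0))"
    unfolding sum_nested_models using assms by (intro sum.cong) (auto simp: nested_index_def)
  also have "\<dots> = (\<Sum>j\<le>k. p (nested_index k j)) - (\<Sum>j\<le>i. p (nested_index k j))"
    unfolding sum_subtractf
    using assms by (intro arg_cong2[where f = minus] refl sum.mono_neutral_cong_right) auto
  finally show ?thesis by (simp add: sum_nested_models)
qed

text \<open>By the preceding formula, variable \<open>i\<close> belongs to the median model iff the partial sum up to \<open>i\<close>
  is at most 1/2. Partial sums are monotone, so these variables form an initial segment, and its
  length is the first index at which the partial sum exceeds 1/2.\<close>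

lemma median_model_nested:
  assumes nonneg: "\<And>l. l \<in> nested_models k \<Longrightarrow> p l \<ge> 0"
    and total: "(\<Sum>l\<in>nested_models k. p l) = 1"
  obtains m where "m \<le> k" "median_model k (nested_models k) p = nested_index k m"
    "(\<Sum>i<m. p (nested_index k i)) \<le> 1 / 2" "(\<Sum>i\<le>m. p (nested_index k i)) \<ge> 1 / 2"
proof -
  define F where "F i = (\<Sum>r\<le>i. p (nested_index k r))" for i
  have F_mono: "F i \<le> F j" if "i \<le> j" "j \<le> k" for i j
    unfolding F_def using that by (intro sum_mono2) (auto intro!: nonneg simp: nested_models_def)
  have F_k: "F k = 1" using total by (simp add: F_def sum_nested_models)
  define m where "m = (LEAST m. F m > 1 / 2)"
  have m: "F m > 1 / 2" "m \<le> k"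
    unfolding m_def by (rule LeastI[of _ k], simp add: F_k) (rule Least_le, simp add: F_k)
  have below: "F i \<le> 1 / 2" if "i < m" for i
    using not_less_Least[of i "\<lambda>m. F m > 1 / 2"] that unfolding m_def by simp
  have iff: "F i \<le> 1 / 2 \<longleftrightarrow> i < m" if "i < k" for i
    using below[of i] F_mono[of m i] m that by (cases "i < m") auto
  have "median_model k (nested_models k) p = nested_index k m"
    unfolding median_model_def nested_index_def[of k m]
  proof (intro eq_vecI, unfold dim_vec)
    fix i assume i: "i < k"
    have "inclusion_prob (nested_models k) p i = 1 - F i"
      using inclusion_prob_nested[OF i] total by (simp add: F_def)
    then show "vec k (\<lambda>i. if inclusion_prob (nested_models k) p i \<ge> 1 / 2 then 1 else 0) $ i
        = vec k (\<lambda>i. if i < m then 1 else 0) $ i"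
      using iff[OF i] i by auto
  qed simp
  moreover have "(\<Sum>i<m. p (nested_index k i)) \<le> 1 / 2"
    using below[of "m - 1"] by (cases m) (auto simp: F_def lessThan_Suc_atMost)
  ultimately show ?thesis
    using that m by (simp add: F_def less_imp_le)
qed

section \<open>Predictive risk along the nested sequence\<close>

text \<open>The hypothesis on \<open>c\<close> is the only trace of least squares here: it makes the embedded means a
  sequence with orthogonal increments, so that \<open>c i\<close> measures how far along the sequence model \<open>i\<close>
  is. Squared distances between embedded means are then differences of \<open>c\<close>, and the expected squared
  distance to a random model is an expected absolute deviation.\<close>

lemma nested_risk_eq_abs_deviation:
  fixes Q :: "real mat"
  assumes Q: "positive_definite k Q"
    and v: "\<And>j. j \<le> k \<Longrightarrow> embedded_mean post (nested_index k j) \<in> carrier_vec k"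
    and c: "\<And>i j. i \<le> j \<Longrightarrow> j \<le> k \<Longrightarrow>
      embedded_mean post (nested_index k i) \<bullet> (Q *\<^sub>v embedded_mean post (nested_index k j)) = c i"
    and total: "(\<Sum>l\<in>nested_models k. p l) = 1"
  shows "\<And>i j. i \<le> j \<Longrightarrow> j \<le> k \<Longrightarrow> c i \<le> c j"
    and "\<exists>a. \<forall>j\<le>k. predictive_risk Q (nested_models k) p post (nested_index k j)
      = (\<Sum>i\<le>k. p (nested_index k i) * \<bar>c i - c j\<bar>) + a"
proof -
  define V where "V j = embedded_mean post (nested_index k j)" for j
  have Vc: "V j \<in> carrier_vec k" if "j \<le> k" for j using v that by (simp add: V_def)
  have Qc: "Q \<in> carrier_mat k k" and Qsym: "Q\<^sup>T = Q" using Q by (auto simp: positive_definite_def)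
  have sym: "u \<bullet> (Q *\<^sub>v w) = w \<bullet> (Q *\<^sub>v u)" if "u \<in> carrier_vec k" "w \<in> carrier_vec k" for u w
    using transpose_vec_mult_scalar[OF Qc, of u w] that Qc
    by (simp add: Qsym comm_scalar_prod[of u k])
  have diff: "(u - w) \<bullet> (Q *\<^sub>v (u - w)) = u \<bullet> (Q *\<^sub>v u) - 2 * (u \<bullet> (Q *\<^sub>v w)) + w \<bullet> (Q *\<^sub>v w)"
    if "u \<in> carrier_vec k" "w \<in> carrier_vec k" for u w
    using that Qc sym[OF that]
    by (simp add: mult_minus_distrib_mat_vec[OF Qc] minus_scalar_prod_distrib[of _ k]
        scalar_prod_minus_distrib[of _ k])
  have V_le: "V i \<bullet> (Q *\<^sub>v V j) = c i" if "i \<le> j" "j \<le> k" for i j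
    using c that by (simp add: V_def)
  show mono: "c i \<le> c j" if ij: "i \<le> j" "j \<le> k" for i j
  proof -
    let ?d = "V i - V j"
    have cs: "V i \<in> carrier_vec k" "V j \<in> carrier_vec k" using ij Vc by auto
    have "0 \<le> ?d \<bullet> (Q *\<^sub>v ?d)"
    proof (cases "?d = 0\<^sub>v k")
      case True
      then show ?thesis using Qc by simp
    next
      case False
      then show ?thesis using Q cs by (auto simp: positive_definite_def intro: less_imp_le)
    qed
    also have "\<dots> = c j - c i"
      using diff[OF cs] V_le[OF ij] V_le[of i i] V_le[of j j] ij by simp
    finally show ?thesis by simp
  qed
  have V_min: "V j \<bullet> (Q *\<^sub>v V i) = min (c i) (c j)" if "i \<le> k" "j \<le> k" for i j
    using V_le[of i j] V_le[of j i] mono[of i j] mono[of j i] sym[OF Vc Vc] that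
    by (cases "i \<le> j") (auto simp: min_def)
  define avg where "avg = model_average k (nested_models k) p post"
  have fin: "finite (nested_models k)" by (simp add: nested_models_def)
  have terms: "(\<lambda>l. p l \<cdot>\<^sub>v embedded_mean post l) \<in> nested_models k \<rightarrow> carrier_vec k"
    using v by (auto simp: nested_models_def)
  have avgc: "avg \<in> carrier_vec k"
    unfolding avg_def model_average_def by (rule finsum_vec_closed[OF terms])
  have V_avg: "V j \<bullet> (Q *\<^sub>v avg) = (\<Sum>i\<le>k. p (nested_index k i) * min (c i) (c j))"
    if j: "j \<le> k" for j
  proof -
    have QV: "Q *\<^sub>v V j \<in> carrier_vec k" using Qc Vc[OF j] by simp
    have "V j \<bullet> (Q *\<^sub>v avg) = (Q *\<^sub>v V j) \<bullet> avg"
      using sym[OF Vc[OF j] avgc] comm_scalar_prod[OF avgc QV] by simp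
    also have "\<dots> = (\<Sum>i\<le>k. (Q *\<^sub>v V j) \<bullet> (p (nested_index k i) \<cdot>\<^sub>v V i))"
      unfolding avg_def model_average_def scalar_prod_finsum_vec[OF fin QV terms]
      by (simp add: sum_nested_models V_def)
    also have "\<dots> = (\<Sum>i\<le>k. p (nested_index k i) * min (c i) (c j))"
    proof (intro sum.cong refl)
      fix i assume "i \<in> {..k}"
      then have i: "i \<le> k" by simp
      have "(Q *\<^sub>v V j) \<bullet> V i = min (c i) (c j)"
        using comm_scalar_prod[OF QV Vc[OF i]] V_min[OF j i] by (simp add: min.commute)
      then show "(Q *\<^sub>v V j) \<bullet> (p (nested_index k i) \<cdot>\<^sub>v V i) = p (nested_index k i) * min (c i) (c j)"
        using QV Vc[OF i] by simp
    qed
    finally show ?thesis .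
  qed
  have p_sum: "(\<Sum>i\<le>k. p (nested_index k i)) = 1"
    using total by (simp add: sum_nested_models)
  define a where "a = avg \<bullet> (Q *\<^sub>v avg) - (\<Sum>i\<le>k. p (nested_index k i) * c i)"
  have "predictive_risk Q (nested_models k) p post (nested_index k j)
      = (\<Sum>i\<le>k. p (nested_index k i) * \<bar>c i - c j\<bar>) + a" if j: "j \<le> k" for j
  proof -
    have "predictive_risk Q (nested_models k) p post (nested_index k j)
        = (V j - avg) \<bullet> (Q *\<^sub>v (V j - avg))"
      using Qc by (simp add: predictive_risk_def Let_def V_def avg_def)
    also have "\<dots> = c j * (\<Sum>i\<le>k. p (nested_index k i))
        - 2 * (\<Sum>i\<le>k. p (nested_index k i) * min (c i) (c j)) + avg \<bullet> (Q *\<^sub>v avg)"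
      using diff[OF Vc[OF j] avgc] V_avg[OF j] V_le[of j j] j p_sum by simp
    also have "\<dots> = (\<Sum>i\<le>k. p (nested_index k i) * (c i + c j - 2 * min (c i) (c j))) + a"
      by (simp add: a_def sum.distrib sum_subtractf sum_distrib_left algebra_simps)
    also have "(\<lambda>i. p (nested_index k i) * (c i + c j - 2 * min (c i) (c j)))
        = (\<lambda>i. p (nested_index k i) * \<bar>c i - c j\<bar>)"
      by (auto simp: min_def)
    finally show ?thesis .
  qed
  then show "\<exists>a. \<forall>j\<le>k. predictive_risk Q (nested_models k) p post (nested_index k j)
      = (\<Sum>i\<le>k. p (nested_index k i) * \<bar>c i - c j\<bar>) + a"
    by blast
qed

text \<open>The right-hand side of the inner product formula does not mention \<open>j\<close>. This holds because \<open>V i\<close>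
  lies in the coefficient space of the larger model \<open>j\<close>, where the normal equations allow the fitted
  values of \<open>V j\<close> to be replaced by \<open>b\<close> times \<open>y\<close>.\<close>

lemma nested_embedded_means:
  fixes X :: "real mat"
  assumes X: "X \<in> carrier_mat n k" and y: "y \<in> carrier_vec n"
    and Q: "positive_definite k Q" and Q_eq: "Q = \<gamma> \<cdot>\<^sub>m (X\<^sup>T * X)"
    and mean: "\<And>j. j \<le> k \<Longrightarrow>
      posterior_mean j (post (nested_index k j)) = b \<cdot>\<^sub>v least_squares X y (nested_index k j)"
  defines "V \<equiv> \<lambda>j. embedded_mean post (nested_index k j)"
  shows "\<And>j. j \<le> k \<Longrightarrow> V j \<in> carrier_vec k"
    and "\<And>i j. i \<le> j \<Longrightarrow> j \<le> k \<Longrightarrow> V i \<bullet> (Q *\<^sub>v V j) = \<gamma> * b * ((X *\<^sub>v V i) \<bullet> y)"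
proof -
  let ?H = "\<lambda>j. embed_mat (nested_index k j)"
  let ?B = "\<lambda>j. least_squares X y (nested_index k j)"
  have H: "?H j \<in> carrier_mat k j" if "j \<le> k" for j
    using that by (rule embed_mat_nested_carrier)
  have V: "V j = ?H j *\<^sub>v posterior_mean j (post (nested_index k j))" if "j \<le> k" for j
    using that by (simp add: V_def embedded_mean_def model_size_nested)
  have form: "u \<bullet> (Q *\<^sub>v w) = \<gamma> * ((X *\<^sub>v u) \<bullet> (X *\<^sub>v w))"
    if u: "u \<in> carrier_vec k" and w: "w \<in> carrier_vec k" for u w
  proof -
    have "(\<gamma> \<cdot>\<^sub>m G) *\<^sub>v w = \<gamma> \<cdot>\<^sub>v (G *\<^sub>v w)" if "G \<in> carrier_mat k k" for G
      using that w by (intro eq_vecI) auto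
    then have "Q *\<^sub>v w = \<gamma> \<cdot>\<^sub>v ((X\<^sup>T * X) *\<^sub>v w)"
      unfolding Q_eq using X by simp
    then show ?thesis using gram_scalar_prod[OF X u w] X u w by simp
  qed
  \<comment> \<open>Positive definiteness of \<open>Q\<close> supplies full column rank of \<open>X\<close>, and with it that of each submodel.\<close>
  have X_inj: "u = 0\<^sub>v k" if u: "u \<in> carrier_vec k" and "X *\<^sub>v u = 0\<^sub>v n" for u
    using form[OF u u] that Q by (fastforce simp: positive_definite_def)
  have pm: "posterior_mean j N \<in> carrier_vec j" for j N
    by (simp add: posterior_mean_def)
  show Vc: "V j \<in> carrier_vec k" if j: "j \<le> k" for j
    unfolding V[OF j] using H[OF j] pm by simp
  show "V i \<bullet> (Q *\<^sub>v V j) = \<gamma> * b * ((X *\<^sub>v V i) \<bullet> y)" if ij: "i \<le> j" and j: "j \<le> k" for i j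
  proof -
    \<comment> \<open>The design of model \<open>j\<close>, and \<open>V i\<close> in the coordinates of model \<open>j\<close>.\<close>
    define A where "A = X * ?H j"
    define w where "w = embed_mat (nested_index j i) *\<^sub>v posterior_mean i (post (nested_index k i))"
    have i: "i \<le> k" using ij j by simp
    have A: "A \<in> carrier_mat n j" unfolding A_def using X H[OF j] by simp
    have A_vec: "A *\<^sub>v z = X *\<^sub>v (?H j *\<^sub>v z)" if "z \<in> carrier_vec j" for z
      unfolding A_def using assoc_mult_mat_vec[OF X H[OF j] that] .
    have w: "w \<in> carrier_vec j"
      unfolding w_def using embed_mat_nested_carrier[OF ij] pm by simp
    have Vi: "V i = ?H j *\<^sub>v w"
      unfolding V[OF i] w_def embed_mat_nested_trans[OF ij j, symmetric]
      using assoc_mult_mat_vec[OF H[OF j] embed_mat_nested_carrier[OF ij] pm] .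
    have A_inj: "z = 0\<^sub>v j" if z: "z \<in> carrier_vec j" and "A *\<^sub>v z = 0\<^sub>v n" for z
      using that A_vec[OF z] X_inj[of "?H j *\<^sub>v z"] embed_mat_nested_inj[OF j z] H[OF j] by simp
    have B_eq: "?B j = the (mat_inverse (A\<^sup>T * A)) *\<^sub>v (A\<^sup>T *\<^sub>v y)"
      by (simp add: least_squares_def A_def submodel_design_nested[OF X j])
    note ne = normal_equations[OF A y A_inj w B_eq]
    have Vj: "X *\<^sub>v V j = b \<cdot>\<^sub>v (A *\<^sub>v ?B j)"
      unfolding V[OF j] mean[OF j] using A ne(1)
      by (simp add: mult_mat_vec[OF A ne(1)] flip: A_vec)
    have "V i \<bullet> (Q *\<^sub>v V j) = \<gamma> * ((A *\<^sub>v w) \<bullet> (b \<cdot>\<^sub>v (A *\<^sub>v ?B j)))"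
      using form[OF Vc[OF i] Vc[OF j]] Vj Vi A_vec[OF w] by simp
    also have "\<dots> = \<gamma> * b * ((A *\<^sub>v w) \<bullet> y)"
      using ne A w by simp
    finally show ?thesis using Vi A_vec[OF w] by simp
  qed
qed

theorem theorem2:
  fixes n k :: nat
    and X :: "real mat"
    and y :: "real vec"
    and p :: "nat vec \<Rightarrow> real"
    and post :: "nat vec \<Rightarrow> ((nat \<Rightarrow> real) \<times> real) measure"
    and M :: "'w measure"
    and x_star :: "'w \<Rightarrow> real mat"
    and Q :: "real mat"
    and L :: "nat vec set"
    and \<gamma> b :: real
  assumes "k < n"
    and "X \<in> carrier_mat n k"
    and "vec_space.rank n X = k"
    and "y \<in> carrier_vec n"
    and L_def: "L = nested_models k"
    and "\<And>l. l \<in> L \<Longrightarrow> p l \<ge> 0"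
    and "(\<Sum>l\<in>L. p l) = 1"
    and "\<And>l. l \<in> L \<Longrightarrow> posterior_with_mean (model_size l) (post l)"
    and "prob_space M"
    and "random_row k M x_star"
    and "second_moment_exists k M x_star"
    and Q_def: "Q = second_moment k M x_star"
    and "positive_definite k Q"
    and "\<gamma> > 0" and "Q = \<gamma> \<cdot>\<^sub>m (X\<^sup>T * X)"
    and "b > 0"
    and "\<And>l. l \<in> L \<Longrightarrow>
           posterior_mean (model_size l) (post l) = b \<cdot>\<^sub>v least_squares X y l"
  shows "best_predictive_model Q L p post (median_model k L p) \<and>
    (\<exists>j. is_median_position k p j) \<and>
    (\<forall>j. is_median_position k p j \<longrightarrow>
       best_predictive_model Q L p post (nested_index k j))"
proof -
  define V where "V j = embedded_mean post (nested_index k j)" for j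
  define c where "c j = \<gamma> * b * ((X *\<^sub>v V j) \<bullet> y)" for j
  have in_L: "nested_index k j \<in> L" if "j \<le> k" for j
    using that by (auto simp: L_def nested_models_def)
  have mean: "posterior_mean j (post (nested_index k j)) = b \<cdot>\<^sub>v least_squares X y (nested_index k j)"
    if "j \<le> k" for j
    using assms(17)[OF in_L[OF that]] model_size_nested[OF that] by simp
  note means = nested_embedded_means[OF assms(2,4,13,15) mean, folded V_def, folded c_def]
  have total: "(\<Sum>l\<in>nested_models k. p l) = 1"
    using assms(7) by (simp add: L_def)
  note risk = nested_risk_eq_abs_deviation[OF assms(13) means[unfolded V_def] total]
  obtain a where a: "\<And>j. j \<le> k \<Longrightarrow> predictive_risk Q L p post (nested_index k j)
      = (\<Sum>i\<le>k. p (nested_index k i) * \<bar>c i - c j\<bar>) + a"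
    using risk(2) unfolding L_def by blast
  have p_sum: "(\<Sum>i\<le>k. p (nested_index k i)) = 1"
    using total by (simp add: sum_nested_models)
  have best: "best_predictive_model Q L p post (nested_index k m)"
    if m: "m \<le> k" "(\<Sum>i<m. p (nested_index k i)) \<le> 1 / 2" "(\<Sum>i\<le>m. p (nested_index k i)) \<ge> 1 / 2"
    for m
    unfolding best_predictive_model_def is_arg_min_linorder
  proof (intro conjI allI impI in_L m)
    fix l assume "l \<in> L"
    then obtain j where j: "j \<le> k" and l: "l = nested_index k j"
      by (auto simp: L_def nested_models_def)
    have "(\<Sum>i\<le>k. p (nested_index k i) * \<bar>c i - c m\<bar>)
        \<le> (\<Sum>i\<le>k. p (nested_index k i) * \<bar>c i - c j\<bar>)"
      using assms(6)[OF in_L] p_sum risk(1) m j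
      by (intro weighted_median_minimizes_abs_deviation) auto
    then show "predictive_risk Q L p post (nested_index k m) \<le> predictive_risk Q L p post l"
      unfolding l a[OF j] a[OF m(1)] by simp
  qed
  obtain m where "m \<le> k" "median_model k L p = nested_index k m"
    "(\<Sum>i<m. p (nested_index k i)) \<le> 1 / 2" "(\<Sum>i\<le>m. p (nested_index k i)) \<ge> 1 / 2"
    using median_model_nested[OF assms(6)[unfolded L_def] total] unfolding L_def by blast
  then have "best_predictive_model Q L p post (median_model k L p)"
    using best by simp
  moreover have "\<exists>j. is_median_position k p j"
    using exists_weighted_median[of "\<lambda>i. p (nested_index k i)" k] p_sum
    by (auto simp: is_median_position_def)
  moreover have "\<forall>j. is_median_position k p j \<longrightarrow> best_predictive_model Q L p post (nested_index k j)"
    using best by (auto simp: is_median_position_def)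
  ultimately show ?thesis by blast
qed

end
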